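(* Let $p$ be a prime, let $A\in GL_2(\mathbb{F}_p)$ be a simple matrix, let $d\in\mathbb{F}_p$ satisfy $d^2=\det A$, and suppose that $\operatorname{tr}A+2d$ is a square in $\mathbb{F}_p$ (a quadratic residue or $0$), say $\operatorname{tr}A+2d=s^2$ with $s\in\mathbb{F}_p$. Then the matrices $$\pm\frac{1}{s}\,(A+dE)$$ belong to $GL_2(\mathbb{F}_p)$ and are square roots of $A$.
   Context: $E$ is the identity matrix. A $2\times 2$ matrix over a field is simple if its characteristic polynomial has two distinct roots in an algebraic closure. For simple $A$ one has $(\operatorname{tr}A+2d)(\operatorname{tr}A-2d)=(\operatorname{tr}A)^2-4\det A\neq 0$, so $s\ne 0$ and the formula is meaningful. A square root of $A$ is a matrix $B$ with $B^2=A$. Both choices of the sign of $d$ (i.e. $d=\pm\sqrt{\det A}$) are allowed. *)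

theory Defs
  imports
    "HOL-Algebra.Algebraic_Closure_Type"
    "Jordan_Normal_Form.Char_Poly"
    "Berlekamp_Zassenhaus.Finite_Field"
begin

definition GL :: "nat \<Rightarrow> 'a :: field mat set" where
  "GL n = {A \<in> carrier_mat n n. invertible_mat A}"

definition mat_trace :: "'a :: comm_monoid_add mat \<Rightarrow> 'a" where
  "mat_trace A = (\<Sum>i<dim_row A. A $$ (i, i))"

text \<open>
  The roots are counted as a set, hence without multiplicity. The function \<^const>\<open>to_ac\<close>
  embeds a field into its algebraic closure.
\<close>

definition simple_mat :: "'a :: field mat \<Rightarrow> bool" where
  "simple_mat A \<longleftrightarrow> A \<in> carrier_mat 2 2 \<and>
     card {x :: 'a alg_closure. poly (map_poly to_ac (char_poly A)) x = 0} = 2"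

end

theory Submission
  imports Defs
begin

text \<open>
  By the Cayley-Hamilton theorem, \<open>(A + d E)\<^sup>2 = A\<^sup>2 + 2 d A + (det A) E = (tr A + 2 d) A = s\<^sup>2 A\<close>.
  If \<open>s\<close> were zero, then \<open>tr A = -2 d\<close> and the characteristic polynomial would be
  \<open>(x + d)\<^sup>2\<close>, contradicting simplicity; this argument is uniform in the characteristic.
\<close>

text \<open>Commutative rings rather than fields, because \<open>char_poly_mat_2\<close> also
  applies this to the characteristic matrix, whose entries are polynomials.\<close>

lemma det_mat_2:
  fixes A :: "'a :: comm_ring_1 mat"
  assumes A: "A \<in> carrier_mat 2 2"
  shows "det A = A $$ (0, 0) * A $$ (1, 1) - A $$ (0, 1) * A $$ (1, 0)"
  unfolding laplace_expansion_column[OF A, of 0, simplified]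
  using A by (simp add: cofactor_def mat_delete_def det_single numeral_2_eq_2 algebra_simps)

lemma mat_trace_2: "A \<in> carrier_mat 2 2 \<Longrightarrow> mat_trace A = A $$ (0, 0) + A $$ (1, 1)"
  by (simp add: mat_trace_def numeral_2_eq_2)

lemma char_poly_mat_2:
  fixes A :: "'a :: comm_ring_1 mat"
  assumes A: "A \<in> carrier_mat 2 2"
  shows "char_poly A = [:det A, - mat_trace A, 1:]"
  unfolding char_poly_defs
  by (subst det_mat_2) (use A in \<open>simp_all add: det_mat_2[OF A] mat_trace_2[OF A]\<close>)

lemma simple_mat_trace_neq:
  assumes simple: "simple_mat A" and d: "d ^ 2 = det A"
  shows "mat_trace A + 2 * d \<noteq> 0"
proof
  assume "mat_trace A + 2 * d = 0"
  then have tr: "- mat_trace A = 2 * d"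
    by (metis add_eq_0_iff)
  have "char_poly A = [:d ^ 2, 2 * d, 1:]"
    using simple by (simp add: simple_mat_def char_poly_mat_2 tr d)
  \<comment> \<open>A perfect square over the closure leaves a single root, whereas simplicity
    demands two distinct ones. Nothing is divided by 2.\<close>
  then have "poly (map_poly to_ac (char_poly A)) x = (x + to_ac d) ^ 2" for x
    by (simp add: map_poly_pCons power2_eq_square algebra_simps)
  then have "{x. poly (map_poly to_ac (char_poly A)) x = 0} = {- to_ac d}"
    by (auto simp: add_eq_0_iff2)
  then show False
    using simple by (simp add: simple_mat_def)
qed

text \<open>The identity is checked entrywise: once \<open>d'\<close> replaces \<open>d * d\<close>
  by the explicit determinant, each of the four entries is a commutative ring identity.\<close>

lemma square_shifted_mat_2:
  fixes A :: "'a :: comm_ring_1 mat"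
  assumes A: "A \<in> carrier_mat 2 2" and d: "d ^ 2 = det A"
  shows "(A + d \<cdot>\<^sub>m 1\<^sub>m 2) * (A + d \<cdot>\<^sub>m 1\<^sub>m 2) = (mat_trace A + 2 * d) \<cdot>\<^sub>m A"
proof -
  have d': "d * d = A $$ (0, 0) * A $$ (1, 1) - A $$ (0, 1) * A $$ (1, 0)"
    using d by (simp add: det_mat_2[OF A] power2_eq_square)
  show ?thesis
  proof (rule eq_matI)
    fix i j
    assume "i < dim_row ((mat_trace A + 2 * d) \<cdot>\<^sub>m A)" "j < dim_col ((mat_trace A + 2 * d) \<cdot>\<^sub>m A)"
    then have "i = 0 \<or> i = 1" "j = 0 \<or> j = 1"
      using A by auto
    then show "((A + d \<cdot>\<^sub>m 1\<^sub>m 2) * (A + d \<cdot>\<^sub>m 1\<^sub>m 2)) $$ (i, j) =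
        ((mat_trace A + 2 * d) \<cdot>\<^sub>m A) $$ (i, j)"
      using A d'
      by (auto simp: scalar_prod_def numeral_2_eq_2 mat_trace_2 algebra_simps)
  qed (use A in auto)
qed

text \<open>If \<open>C\<close> inverts \<open>B * B\<close>, then \<open>B * C\<close> is a right
  inverse of \<open>B\<close>, and for square matrices over a field a right inverse is two-sided.
  Thus the roots inherit invertibility from \<open>A\<close>.\<close>

lemma GL_sqrt:
  assumes B: "B \<in> carrier_mat n n" and BB: "B * B \<in> GL n"
  shows "B \<in> GL n"
proof -
  obtain C where C: "B * B * C = 1\<^sub>m n" "C * (B * B) = 1\<^sub>m (dim_row C)"
    using BB B by (auto simp: GL_def invertible_mat_def inverts_mat_def)
  \<comment> \<open>\<open>invertible_mat\<close> does not fix the size of the inverse; comparing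
    the column counts in both equations recovers it.\<close>
  then have "dim_row C = n" "dim_col C = n"
    using B by (metis carrier_matD(2) index_mult_mat(3) index_one_mat(3))+
  then have Cc: "C \<in> carrier_mat n n"
    by auto
  have "B * (B * C) = 1\<^sub>m n"
    using C(1) B Cc by simp
  moreover from this have "(B * C) * B = 1\<^sub>m n"
    using B Cc by (meson mat_mult_left_right_inverse mult_carrier_mat)
  ultimately show ?thesis
    using B Cc by (auto simp: GL_def invertible_mat_def inverts_mat_def)
qed

lemma smult_smult_mat: "a \<cdot>\<^sub>m (b \<cdot>\<^sub>m A) = (a * b) \<cdot>\<^sub>m (A :: 'a :: semigroup_mult mat)"
  by (rule eq_matI) (auto simp: mult.assoc)

theorem corollary15:
  fixes A :: "'p :: prime_card mod_ring mat"
    and d s :: "'p mod_ring"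
  assumes "A \<in> GL 2"
    and "simple_mat A"
    and "d ^ 2 = det A"
    and "mat_trace A + 2 * d = s ^ 2"
  shows "\<forall>B \<in> {(1 / s) \<cdot>\<^sub>m (A + d \<cdot>\<^sub>m 1\<^sub>m 2), - ((1 / s) \<cdot>\<^sub>m (A + d \<cdot>\<^sub>m 1\<^sub>m 2))}.
           B \<in> GL 2 \<and> B ^\<^sub>m 2 = A"
proof -
  let ?M = "A + d \<cdot>\<^sub>m 1\<^sub>m 2"
  have A: "A \<in> carrier_mat 2 2"
    using assms(1) by (simp add: GL_def)
  then have M: "?M \<in> carrier_mat 2 2"
    by simp
  have s: "s \<noteq> 0"
    using simple_mat_trace_neq[OF assms(2,3)] assms(4) by auto
  \<comment> \<open>The scalars \<open>c\<close> with this property are exactly 1/s and -1/s, so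
    both signs are handled at once.\<close>
  have *: "c \<cdot>\<^sub>m ?M \<in> GL 2 \<and> (c \<cdot>\<^sub>m ?M) ^\<^sub>m 2 = A" if c: "c * c * s ^ 2 = 1" for c
  proof -
    have "(c \<cdot>\<^sub>m ?M) * (c \<cdot>\<^sub>m ?M) = (c * c) \<cdot>\<^sub>m (?M * ?M)"
      by (simp only: mult_smult_assoc_mat[OF M smult_carrier_mat[OF M]]
          mult_smult_distrib[OF M M] smult_smult_mat)
    \<comment> \<open>The square of \<open>?M\<close> is \<open>s ^ 2\<close> times
      \<open>A\<close>, and the condition on \<open>c\<close> cancels that factor.\<close>
    also have "\<dots> = A"
      using square_shifted_mat_2[OF A assms(3)] assms(4) c
      by (intro eq_matI) (simp_all add: mult.assoc[symmetric])
    finally have sq: "(c \<cdot>\<^sub>m ?M) * (c \<cdot>\<^sub>m ?M) = A" .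
    moreover have "(c \<cdot>\<^sub>m ?M) ^\<^sub>m 2 = (c \<cdot>\<^sub>m ?M) * (c \<cdot>\<^sub>m ?M)"
      using M by (simp add: numeral_2_eq_2)
    ultimately show ?thesis
      using GL_sqrt[of "c \<cdot>\<^sub>m ?M" 2] M assms(1) by simp
  qed
  \<comment> \<open>Moving the sign into the scalar turns the second root into an instance of
    \<open>*\<close>.\<close>
  have neg: "- ((1 / s) \<cdot>\<^sub>m ?M) = (- (1 / s)) \<cdot>\<^sub>m ?M"
    by (rule eq_matI) auto
  show ?thesis
    using *[of "1 / s"] *[of "- (1 / s)"] s
    by (simp add: neg power2_eq_square)
qed

end
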